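(* There is a class of instances of the (maximum-weight) independent set problem in the postponement variant, with $n$ candidates, in which every optimal solution $I^*$ has size $|I^*| = 3\ln n$, and for which the expected number of postponements $R$ of MaintainOPT satisfies $\mathbb{E}[R] = \Omega(n \ln\ln n)$.
   Context: Independent set problem: the candidates are the $n$ vertices of a graph, each with a positive weight; feasible solutions are independent sets; the objective is the total weight. At its first arrival, a vertex reveals its weight and its edges to previously arrived vertices; the weights are unknown beforehand. Postponement variant: a pool initially contains all $n$ candidates; in each step a uniformly random candidate from the pool arrives; the algorithm accepts, rejects (both irrevocable, removing it from the pool) or postpones it (returning it to the pool); $R$ is the total number of postponements. MaintainOPT is the algorithm that outputs an optimal (maximum-weight) solution with certainty, and upon each arrival accepts (resp. rejects) the arriving candidate only when the information revealed so far determines that it belongs (resp. does not belong) to the optimal solution for every possible completion of the unseen part of the instance, and postpones it otherwise. Expectations are over the random arrivals. *)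

theory Defs
  imports "HOL-Probability.SPMF"
begin

record 'a wgraph =
  verts :: "'a set"
  weight :: "'a \<Rightarrow> real"
  edges :: "'a set set"

definition valid :: "'a wgraph \<Rightarrow> bool" where
  "valid G \<longleftrightarrow> finite (verts G) \<and> (\<forall>v\<in>verts G. weight G v > 0)
     \<and> (\<forall>e\<in>edges G. e \<subseteq> verts G \<and> card e = 2)"

definition independent_set :: "'a wgraph \<Rightarrow> 'a set \<Rightarrow> bool" where
  "independent_set G S \<longleftrightarrow> S \<subseteq> verts G \<and> (\<forall>u\<in>S. \<forall>v\<in>S. {u, v} \<notin> edges G)"

definition optimal :: "'a wgraph \<Rightarrow> 'a set \<Rightarrow> bool" where
  "optimal G S \<longleftrightarrow> independent_set G S
     \<and> (\<forall>T. independent_set G T \<longrightarrow> sum (weight G) T \<le> sum (weight G) S)"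

(* The instances that cannot be distinguished from G once exactly the vertices in S have been
   revealed: a revealed vertex shows its weight and its edges to the other revealed vertices.
   The set of candidates is known, everything concerning an unseen vertex is arbitrary. *)
definition completions :: "'a wgraph \<Rightarrow> 'a set \<Rightarrow> 'a wgraph set" where
  "completions G S = {H. valid H \<and> verts H = verts G
     \<and> (\<forall>v\<in>S. weight H v = weight G v)
     \<and> (\<forall>u\<in>S. \<forall>v\<in>S. {u, v} \<in> edges H \<longleftrightarrow> {u, v} \<in> edges G)}"

(* Whatever the unseen part is, some optimal solution contains A and avoids B. *)
definition safe :: "'a wgraph \<Rightarrow> 'a set \<Rightarrow> 'a set \<Rightarrow> 'a set \<Rightarrow> bool" where
  "safe G S A B \<longleftrightarrow> (\<forall>H\<in>completions G S. \<exists>T. optimal H T \<and> A \<subseteq> T \<and> T \<inter> B = {})"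

datatype decision = Accept | Reject | Postpone

(* The decision of MaintainOPT on the arrival of v, where S is the set of revealed vertices
   (v included) and A and B are the sets of vertices accepted and rejected before. Optimal
   solutions need not be unique: "v belongs (does not belong) to the optimal solution" means that
   taking (discarding) v leaves an optimal solution that is consistent with the earlier
   decisions. So "safe G S A B" is an invariant, and the output is always optimal. Where
   both decisions are safe the tie is resolved by accepting. *)
definition maintain_opt ::
    "'a wgraph \<Rightarrow> 'a set \<Rightarrow> 'a set \<Rightarrow> 'a set \<Rightarrow> 'a \<Rightarrow> decision" where
  "maintain_opt G S A B v =
     (if safe G S (insert v A) B then Accept
      else if safe G S A (insert v B) then Reject
      else Postpone)"

(* Distribution of the number of postponements from the state (S, A, B) until the pool is empty.
   A run that never empties the pool contributes no mass, which could only decrease the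
   expectation below. *)
partial_function (spmf) postponements ::
    "'a wgraph \<Rightarrow> 'a set \<Rightarrow> 'a set \<Rightarrow> 'a set \<Rightarrow> nat spmf" where
  "postponements G S A B =
     (if verts G - (A \<union> B) = {} then return_spmf 0
      else bind_spmf (spmf_of_set (verts G - (A \<union> B))) (\<lambda>v.
        case maintain_opt G (insert v S) A B v of
          Accept \<Rightarrow> postponements G (insert v S) (insert v A) B
        | Reject \<Rightarrow> postponements G (insert v S) A (insert v B)
        | Postpone \<Rightarrow> map_spmf Suc (postponements G (insert v S) A B)))"

definition expected_postponements :: "'a wgraph \<Rightarrow> ennreal" where
  "expected_postponements G =
     (\<integral>\<^sup>+ r. of_nat r \<partial>measure_spmf (postponements G {} {} {}))"

end

theory Submission
  imports Defs "HOL-Analysis.Harmonic_Numbers" "HOL-Real_Asymp.Real_Asymp"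
begin

text \<open>
  While some vertex u is unseen, u may turn out to be so heavy that it lies in every optimal
  solution, and its edges may exclude any given seen vertex or all seen vertices but one. Hence
  MaintainOPT postpones every arrival until all n vertices have been seen, and none afterwards. This is the coupon
  collector process, which needs n * harm n steps in expectation, and all but at most n of them are
  postponements. Since ln (ln n) <= ln n - 1, the bound follows with constant 1, and it does not
  depend on the graph.
\<close>

section \<open>Optimal solutions and decisions\<close>

text \<open>\<open>independent_set\<close> also tests the pair \<open>u = v\<close>, so this is what
  makes a single vertex independent.\<close>

lemma singleton_not_edge: "valid G \<Longrightarrow> {v} \<notin> edges G"
  unfolding valid_def by fastforce

lemma independent_set_singleton:
  "valid G \<Longrightarrow> v \<in> verts G \<Longrightarrow> independent_set G {v}"
  by (simp add: independent_set_def singleton_not_edge)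

lemma optimal_exists:
  assumes "valid G"
  shows "\<exists>T. optimal G T"
proof -
  let ?I = "{S. independent_set G S}"
  have "?I \<subseteq> Pow (verts G)"
    by (auto simp: independent_set_def)
  then have fin: "finite ?I"
    using assms by (meson finite_Pow_iff finite_subset valid_def)
  have "{} \<in> ?I"
    by (simp add: independent_set_def)
  then have "Max (sum (weight G) ` ?I) \<in> sum (weight G) ` ?I"
    using fin by (intro Max_in) auto
  then obtain T where "T \<in> ?I" "sum (weight G) T = Max (sum (weight G) ` ?I)"
    by auto
  then show ?thesis
    using fin by (auto simp: optimal_def intro!: exI[of _ T])
qed

text \<open>\<open>{u}\<close> alone is feasible and outweighs every set that avoids
  \<open>u\<close>.\<close>

lemma heavy_vertex_in_optimal:
  assumes "valid H" "u \<in> verts H" "optimal H T"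
    and heavy: "sum (weight H) (verts H - {u}) < weight H u"
  shows "u \<in> T"
proof (rule ccontr)
  assume "u \<notin> T"
  then have "T \<subseteq> verts H - {u}"
    using assms by (auto simp: optimal_def independent_set_def)
  then have "sum (weight H) T \<le> sum (weight H) (verts H - {u})"
    using assms(1) by (intro sum_mono2) (auto simp: valid_def less_imp_le)
  moreover have "weight H u \<le> sum (weight H) T"
    using assms(3) independent_set_singleton[OF assms(1,2)] by (force simp: optimal_def)
  ultimately show False
    using heavy by simp
qed

text \<open>The adversary against early decisions: an unseen \<open>u\<close> may dominate all other
  weights and have any neighbourhood \<open>N\<close>. Below, \<open>N\<close> is \<open>{v}\<close>
  or everything but \<open>u\<close> and \<open>v\<close>.\<close>

lemma heavy_completion:
  assumes G: "valid G" and u: "u \<in> verts G" "u \<notin> S" and N: "N \<subseteq> verts G - {u}"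
  obtains H where "H \<in> completions G S" "valid H" "verts H = verts G"
    "\<And>x. x \<in> N \<longleftrightarrow> {u, x} \<in> edges H"
    "\<And>T. optimal H T \<Longrightarrow> u \<in> T"
proof
  \<comment> \<open>Only edges inside \<open>S\<close> have been revealed; all others are replaced
    by a star, so the neighbourhood of \<open>u\<close> is exactly \<open>N\<close>.\<close>
  define H where "H = \<lparr>verts = verts G,
    weight = (weight G)(u := 1 + sum (weight G) (verts G - {u})),
    edges = {e \<in> edges G. e \<subseteq> S} \<union> (\<lambda>x. {u, x}) ` N\<rparr>"
  have "0 \<le> sum (weight G) (verts G - {u})"
    using G by (intro sum_nonneg) (auto simp: valid_def less_imp_le)
  moreover have "card {u, x} = 2" if "x \<in> N" for x
    using that N by (subst card_2_iff) blast
  ultimately show vH: "valid H"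
    using G u N by (auto simp: valid_def H_def)
  show "verts H = verts G"
    by (simp add: H_def)
  show "H \<in> completions G S"
    using vH u by (auto simp: completions_def H_def doubleton_eq_iff)
  show "x \<in> N \<longleftrightarrow> {u, x} \<in> edges H" for x
    using u by (auto simp: H_def doubleton_eq_iff)
  show "u \<in> T" if "optimal H T" for T
    using vH _ that
  proof (rule heavy_vertex_in_optimal)
    show "u \<in> verts H"
      using u by (simp add: H_def)
    have "sum (weight H) (verts H - {u}) = sum (weight G) (verts G - {u})"
      by (auto simp: H_def intro: sum.cong)
    then show "sum (weight H) (verts H - {u}) < weight H u"
      by (simp add: H_def)
  qed
qed

text \<open>Joining the heavy vertex \<open>u\<close> to \<open>v\<close> expels \<open>v\<close>
  from every optimal solution.\<close>

lemma not_safe_accept: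
  assumes "valid G" "u \<in> verts G" "u \<notin> S" "v \<in> S" "v \<in> verts G"
  shows "\<not> safe G S {v} {}"
proof
  assume safe: "safe G S {v} {}"
  have "{v} \<subseteq> verts G - {u}"
    using assms by auto
  from heavy_completion[OF assms(1,2,3) this]
  obtain H where H: "H \<in> completions G S" "{u, v} \<in> edges H" "\<And>T. optimal H T \<Longrightarrow> u \<in> T"
    by (metis singletonI)
  from safe H(1) obtain T where "optimal H T" "v \<in> T"
    by (auto simp: safe_def)
  with H show False
    by (auto simp: optimal_def independent_set_def)
qed

text \<open>With \<open>u\<close> adjacent to all but \<open>v\<close>, an optimal solution avoiding
  \<open>v\<close> could only be \<open>{u}\<close>, which adding \<open>v\<close> improves because
  weights are positive.\<close>

lemma not_safe_reject:
  assumes "valid G" "u \<in> verts G" "u \<notin> S" "v \<in> S" "v \<in> verts G"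
  shows "\<not> safe G S {} {v}"
proof
  assume safe: "safe G S {} {v}"
  have "verts G - {u, v} \<subseteq> verts G - {u}"
    by auto
  from heavy_completion[OF assms(1,2,3) this]
  obtain H where H: "H \<in> completions G S" "valid H" "verts H = verts G"
    "\<And>x. x \<in> verts G - {u, v} \<longleftrightarrow> {u, x} \<in> edges H" "\<And>T. optimal H T \<Longrightarrow> u \<in> T"
    by metis
  from safe H(1) obtain T where T: "optimal H T" "v \<notin> T"
    by (auto simp: safe_def)
  have "u \<in> T"
    using H T by blast
  then have "{u, x} \<notin> edges H" "x \<in> verts H" if "x \<in> T" for x
    using that T by (auto simp: optimal_def independent_set_def)
  then have "T \<subseteq> {u}"
    using H(3,4) T by blast
  with \<open>u \<in> T\<close> have "T = {u}"
    by auto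
  have uv: "u \<noteq> v"
    using assms by auto
  have "{u, v} \<notin> edges H" "{v, u} \<notin> edges H"
    using H(4)[of v] by (auto simp: insert_commute)
  then have "independent_set H {u, v}"
    using assms H(2,3) by (auto simp: independent_set_def singleton_not_edge)
  then have "sum (weight H) {u, v} \<le> sum (weight H) T"
    using T by (auto simp: optimal_def)
  then have "weight H v \<le> 0"
    using uv by (simp add: \<open>T = {u}\<close>)
  moreover have "weight H v > 0"
    using H(2,3) assms(5) by (auto simp: valid_def)
  ultimately show False
    by simp
qed

text \<open>Empty \<open>A\<close> and \<open>B\<close> suffice: no decision falls before every
  vertex is seen. \<open>S\<close> already includes the arriving \<open>v\<close>.\<close>

lemma maintain_opt_unseen:
  assumes "valid G" "S \<subset> verts G" "v \<in> S"
  shows "maintain_opt G S {} {} v = Postpone"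
proof -
  obtain u where "u \<in> verts G" "u \<notin> S"
    using assms by auto
  then show ?thesis
    using assms not_safe_accept[of G u S v] not_safe_reject[of G u S v]
    by (auto simp: maintain_opt_def)
qed

text \<open>\<open>completions\<close> compares pairs of vertices only, but validity leaves no other
  edges.\<close>

lemma edges_completion_all:
  assumes "valid G" "H \<in> completions G (verts G)"
  shows "edges H = edges G"
proof (intro set_eqI)
  fix e
  have H: "valid H" "verts H = verts G"
    using assms(2) by (simp_all add: completions_def)
  have "\<exists>u v. e = {u, v} \<and> u \<in> verts G \<and> v \<in> verts G" if "e \<in> edges G \<or> e \<in> edges H"
  proof -
    have "card e = 2" "e \<subseteq> verts G"
      using that assms(1) H by (metis valid_def)+
    then show ?thesis
      by (auto simp: card_2_iff)
  qed
  then show "e \<in> edges H \<longleftrightarrow> e \<in> edges G"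
    using assms(2) by (auto simp: completions_def)
qed

text \<open>The completions now differ from \<open>G\<close> at most in weights outside
  \<open>verts G\<close>, so they have the same optimal solutions.\<close>

lemma safe_all_seen:
  assumes "valid G"
  shows "safe G (verts G) A B \<longleftrightarrow> (\<exists>T. optimal G T \<and> A \<subseteq> T \<and> T \<inter> B = {})"
proof -
  have "optimal H T \<longleftrightarrow> optimal G T" if H: "H \<in> completions G (verts G)" for H T
  proof -
    have ind: "independent_set H T \<longleftrightarrow> independent_set G T" for T
      using H edges_completion_all[OF assms H] by (simp add: independent_set_def completions_def)
    have "sum (weight H) T = sum (weight G) T" if "independent_set G T" for T
      using that H by (intro sum.cong) (auto simp: independent_set_def completions_def)
    then show ?thesis
      by (auto simp: optimal_def ind)
  qed
  moreover have "G \<in> completions G (verts G)"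
    using assms by (simp add: completions_def)
  ultimately show ?thesis
    unfolding safe_def by blast
qed

section \<open>The coupon collector process\<close>

text \<open>An optimal solution consistent with \<open>A\<close> and \<open>B\<close> either
  contains the arriving vertex or not, so one decision is safe. Nothing is postponed and the pool
  shrinks at each step.\<close>

lemma lossless_postponements_all_seen:
  assumes "valid G" "safe G (verts G) A B"
  shows "lossless_spmf (postponements G (verts G) A B)"
  using assms(2)
proof (induction "card (verts G - (A \<union> B))" arbitrary: A B rule: less_induct)
  case less
  have fin: "finite (verts G)"
    using assms by (simp add: valid_def)
  have "lossless_spmf (case maintain_opt G (insert v (verts G)) A B v of
          Accept \<Rightarrow> postponements G (insert v (verts G)) (insert v A) B
        | Reject \<Rightarrow> postponements G (insert v (verts G)) A (insert v B)
        | Postpone \<Rightarrow> map_spmf Suc (postponements G (insert v (verts G)) A B))"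
    if v: "v \<in> verts G - (A \<union> B)" for v
  proof -
    have "safe G (verts G) (insert v A) B \<or> safe G (verts G) A (insert v B)"
      using less.prems v unfolding safe_all_seen[OF assms(1)] by blast
    moreover have "card (verts G - (insert v A \<union> B)) < card (verts G - (A \<union> B))"
      "card (verts G - (A \<union> insert v B)) < card (verts G - (A \<union> B))"
      using v fin by (intro psubset_card_mono; auto)+
    ultimately show ?thesis
      using v less.hyps by (auto simp: maintain_opt_def insert_absorb)
  qed
  then show ?case
    using fin by (subst postponements.simps) auto
qed

definition mean_spmf :: "nat spmf \<Rightarrow> ennreal" where
  "mean_spmf p = (\<integral>\<^sup>+ r. of_nat r \<partial>measure_spmf p)"

text \<open>Without full mass the added 1 would be scaled by the weight of \<open>p\<close>.\<close>

lemma mean_map_Suc: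
  "lossless_spmf p \<Longrightarrow> mean_spmf (map_spmf Suc p) = mean_spmf p + 1"
  by (simp add: mean_spmf_def comp_def nn_integral_add lossless_spmf_def
      measure_spmf.emeasure_eq_measure weight_spmf_def add.commute)

text \<open>Kept free of division, as it serves as a linear equation for an unknown mean.\<close>

lemma mean_bind_spmf_of_set:
  assumes "finite A" "A \<noteq> {}"
  shows "of_nat (card A) * mean_spmf (bind_spmf (spmf_of_set A) f) = (\<Sum>v\<in>A. mean_spmf (f v))"
proof -
  have "mean_spmf (bind_spmf (spmf_of_set A) f) = (\<Sum>v\<in>A. mean_spmf (f v)) / of_nat (card A)"
    unfolding mean_spmf_def
    by (simp add: measure_spmf_bind nn_integral_bind[where B="count_space UNIV"]
        space_subprob_algebra nn_integral_spmf_of_set subprob_space_measure_spmf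
        measurable_def)
  then show ?thesis
    using assms by (simp add: ennreal_times_divide mult.commute[of "of_nat _"]
        mult_divide_eq_ennreal)
qed

lemma weight_bind_spmf_of_set:
  assumes "finite A" "A \<noteq> {}"
  shows "card A * weight_spmf (bind_spmf (spmf_of_set A) f) = (\<Sum>v\<in>A. weight_spmf (f v))"
  using assms by (simp add: weight_bind_spmf integral_spmf_of_set)

text \<open>One arrival while no decision has been made; naming it lets the average over
  \<open>verts G\<close> split into seen and unseen vertices.\<close>

definition arrival :: "'a wgraph \<Rightarrow> 'a set \<Rightarrow> 'a \<Rightarrow> nat spmf" where
  "arrival G S v = (case maintain_opt G (insert v S) {} {} v of
     Accept \<Rightarrow> postponements G (insert v S) {v} {}
   | Reject \<Rightarrow> postponements G (insert v S) {} {v}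
   | Postpone \<Rightarrow> map_spmf Suc (postponements G (insert v S) {} {}))"

lemma postponements_unfold:
  "verts G \<noteq> {} \<Longrightarrow>
    postponements G S {} {} = bind_spmf (spmf_of_set (verts G)) (arrival G S)"
  by (subst postponements.simps) (simp add: arrival_def[abs_def])

lemma arrival_unseen:
  "valid G \<Longrightarrow> insert v S \<subset> verts G \<Longrightarrow>
    arrival G S v = map_spmf Suc (postponements G (insert v S) {} {})"
  by (simp add: arrival_def maintain_opt_unseen)

lemma lossless_arrival_last:
  assumes "valid G" "insert v S = verts G"
  shows "lossless_spmf (arrival G S v)"
proof -
  have "safe G (verts G) {v} {} \<or> safe G (verts G) {} {v}"
    using optimal_exists[OF assms(1)] unfolding safe_all_seen[OF assms(1)] by blast
  then show ?thesis
    using assms by (auto simp: arrival_def maintain_opt_def lossless_postponements_all_seen)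
qed

text \<open>
  From S, an arrival in S leads back to S with one more postponement, so mass and mean solve a
  linear equation in which the terms of the larger sets of seen vertices are known by induction.
\<close>

lemma postponements_coupon_collector:
  assumes G: "valid G" and S: "S \<subseteq> verts G"
  defines "n \<equiv> card (verts G)"
  shows "lossless_spmf (postponements G S {} {}) \<and>
    ennreal (real n * harm (card (verts G - S)) - real (card (verts G - S)))
      \<le> mean_spmf (postponements G S {} {})"
  using S
proof (induction "card (verts G - S)" arbitrary: S)
  case 0
  have fin: "finite (verts G)"
    using G by (simp add: valid_def)
  with 0 have "S = verts G"
    by auto
  moreover have "safe G (verts G) {} {}"
    using optimal_exists[OF G] by (simp add: safe_all_seen[OF G])
  ultimately show ?case
    by (auto simp: harm_def intro: lossless_postponements_all_seen[OF G])
next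
  case (Suc m)
  let ?p = "postponements G S {} {}" and ?V = "verts G"
  \<comment> \<open>The bound claimed for \<open>m\<close> unseen vertices, that is, after one new
    arrival.\<close>
  define b where "b = real n * harm m - real m"
  have fin: "finite ?V"
    using G by (simp add: valid_def)
  have ne: "?V \<noteq> {}"
    using Suc.hyps(2) by auto
  have psub: "S \<subset> ?V"
    using Suc by auto
  have split: "(\<Sum>v\<in>?V. f v) = (\<Sum>v\<in>S. f v) + (\<Sum>v\<in>?V - S. f v)"
    for f :: "'a \<Rightarrow> 'b::comm_monoid_add"
    using fin Suc.prems by (metis add.commute sum.subset_diff)
  have card_n: "n = card S + Suc m"
    using fin Suc by (metis card_Diff_subset card_mono finite_subset le_add_diff_inverse n_def)
  have seen: "arrival G S v = map_spmf Suc ?p" if "v \<in> S" for v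
    using that psub arrival_unseen[OF G, of v S] by (simp add: insert_absorb)
  have new: "lossless_spmf (arrival G S v) \<and> ennreal b \<le> mean_spmf (arrival G S v)"
    if v: "v \<in> ?V - S" for v
  proof -
    have m: "m = card (?V - insert v S)"
      using v Suc.hyps(2) fin by (metis Diff_insert card_Diff_singleton diff_Suc_1)
    show ?thesis
    proof (cases "insert v S = ?V")
      case True
      \<comment> \<open>Here \<open>b\<close> is 0, so only losslessness has content.\<close>
      with m have "m = 0"
        by simp
      then show ?thesis
        using lossless_arrival_last[OF G True] by (simp add: b_def harm_def)
    next
      case False
      then have *: "insert v S \<subset> ?V"
        using v Suc.prems by auto
      then have IH: "lossless_spmf (postponements G (insert v S) {} {})"
        "ennreal b \<le> mean_spmf (postponements G (insert v S) {} {})"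
        using Suc.hyps(1)[OF m] m by (auto simp: b_def)
      \<comment> \<open>No first arrival is credited with a postponement, hence the subtracted
        \<open>card (verts G - S)\<close> in the bound; the added 1 is dropped.\<close>
      then show ?thesis
        by (simp add: arrival_unseen[OF G *] mean_map_Suc add_increasing2)
    qed
  qed
  \<comment> \<open>Mass comes before mean, as \<open>mean_map_Suc\<close> needs losslessness. The
    \<open>card S\<close> seen terms repeat the unknown mass and the other \<open>Suc m\<close> are
    1, which forces it to be 1.\<close>
  have "n * weight_spmf ?p = (\<Sum>v\<in>?V. weight_spmf (arrival G S v))"
    unfolding n_def postponements_unfold[OF ne] by (rule weight_bind_spmf_of_set[OF fin ne])
  also have "\<dots> = (\<Sum>v\<in>S. weight_spmf ?p) + (\<Sum>v\<in>?V - S. 1)"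
    unfolding split using new seen by (intro arg_cong2[where f="(+)"] sum.cong)
      (auto simp: lossless_spmf_def)
  finally have "real (Suc m) * (weight_spmf ?p - 1) = 0"
    using Suc.hyps(2) by (simp add: card_n algebra_simps)
  then have lossless: "lossless_spmf ?p"
    by (simp add: lossless_spmf_def)
  have "of_nat n * mean_spmf ?p = (\<Sum>v\<in>?V. mean_spmf (arrival G S v))"
    unfolding n_def postponements_unfold[OF ne] by (rule mean_bind_spmf_of_set[OF fin ne])
  also have "\<dots> \<ge> (\<Sum>v\<in>S. mean_spmf ?p + 1) + (\<Sum>v\<in>?V - S. ennreal b)"
    unfolding split using new seen lossless
    by (intro add_mono sum_mono) (auto simp: mean_map_Suc)
  finally have ineq: "of_nat (card S) * (mean_spmf ?p + 1) + of_nat (Suc m) * ennreal b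
      \<le> of_nat n * mean_spmf ?p"
    by (simp flip: Suc.hyps(2))
  have "ennreal (real n * harm (Suc m) - real (Suc m)) \<le> mean_spmf ?p"
  \<comment> \<open>Cancelling \<open>card S\<close> times the mean requires it to be finite; an
    infinite mean satisfies the bound trivially.\<close>
  proof (cases "mean_spmf ?p")
    case (real e)
    \<comment> \<open>\<open>ennreal\<close> truncates negative reals to 0, so the passage to reals
      needs \<open>0 \<le> b\<close>.\<close>
    have "m \<le> n * harm m"
    proof (cases "m = 0")
      case False
      then have "1 \<le> (harm m :: real)"
        using harm_mono[of 1 m, where 'a=real] by (simp add: harm_def)
      then have "real n * 1 \<le> real n * harm m"
        by (intro mult_left_mono) auto
      then show ?thesis
        using card_n by linarith
    qed (simp add: harm_def)
    then have "0 \<le> b"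
      by (simp add: b_def)
    then have "ennreal (card S * (e + 1) + Suc m * b) \<le> ennreal (n * e)"
      using ineq real by (simp add: ennreal_mult' ennreal_plus ennreal_of_nat_eq_real_of_nat
          del: of_nat_Suc flip: ennreal_1)
    then have "card S * (e + 1) + Suc m * b \<le> n * e"
      using real by (subst (asm) ennreal_le_iff) auto
    then have "card S + Suc m * b \<le> Suc m * e"
      by (simp add: card_n algebra_simps)
    \<comment> \<open>From \<open>m\<close> to \<open>Suc m\<close> the bound grows by
      \<open>n / Suc m - 1\<close>, which is \<open>card S / Suc m\<close>.\<close>
    moreover have "Suc m * (real n * harm (Suc m) - real (Suc m)) = card S + Suc m * b"
      by (simp add: b_def harm_Suc card_n field_simps)
    ultimately have "Suc m * (real n * harm (Suc m) - real (Suc m)) \<le> Suc m * e"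
      by simp
    then have "real n * harm (Suc m) - real (Suc m) \<le> e"
      by (subst (asm) mult_le_cancel_left_pos) auto
    then show ?thesis
      using real by (auto intro: ennreal_leI)
  qed simp
  then show ?case
    using lossless Suc.hyps(2) by simp
qed

corollary expected_postponements_ge:
  assumes "valid G"
  shows "ennreal (card (verts G) * harm (card (verts G)) - card (verts G))
    \<le> expected_postponements G"
  using postponements_coupon_collector[OF assms, of "{}"]
  by (simp add: expected_postponements_def mean_spmf_def)

section \<open>A family of instances\<close>

text \<open>Vertices below \<open>k - 1\<close> are isolated and the rest form a clique. For
  \<open>0 < k \<le> n\<close> an optimal solution takes the isolated ones and one clique
  vertex.\<close>

definition clique_instance :: "nat \<Rightarrow> nat \<Rightarrow> nat wgraph" where
  "clique_instance n k = \<lparr>verts = {..<n}, weight = (\<lambda>_. 1),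
     edges = {{i, j} | i j. k - 1 \<le> i \<and> i < j \<and> j < n}\<rparr>"

lemma valid_clique_instance: "valid (clique_instance n k)"
  by (auto simp: valid_def clique_instance_def card_2_iff)

lemma card_optimal_clique_instance:
  assumes k: "0 < k" "k \<le> n" and S: "optimal (clique_instance n k) S"
  shows "card S = k"
proof -
  let ?G = "clique_instance n k"
  \<comment> \<open>All isolated vertices and the clique vertex \<open>k - 1\<close>.\<close>
  have "independent_set ?G {..<k}"
    using k by (auto simp: independent_set_def clique_instance_def doubleton_eq_iff)
  then have "k \<le> card S"
    using S by (force simp: optimal_def clique_instance_def)
  have sub: "S \<subseteq> {..<n}" and ind: "\<forall>u\<in>S. \<forall>v\<in>S. {u, v} \<notin> edges ?G"
    using S by (auto simp: optimal_def independent_set_def clique_instance_def)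
  have "\<not> (u < v)" if "u \<in> S - {..<k - 1}" "v \<in> S - {..<k - 1}" for u v
  proof
    assume "u < v"
    then have "{u, v} \<in> edges ?G"
      using that sub by (force simp: clique_instance_def)
    then show False
      using ind that by blast
  qed
  then have "\<forall>u\<in>S - {..<k - 1}. \<forall>v\<in>S - {..<k - 1}. u = v"
    by (metis nat_neq_iff)
  moreover have "finite (S - {..<k - 1})"
    using sub by (auto intro: finite_subset)
  ultimately have "card (S - {..<k - 1}) \<le> 1"
    by (simp add: card_le_Suc0_iff_eq)
  moreover have "card S \<le> card ({..<k - 1} \<union> (S - {..<k - 1}))"
    using sub by (intro card_mono) (auto intro: finite_subset)
  moreover have "\<dots> \<le> card {..<k - 1} + card (S - {..<k - 1})"
    by (rule card_Un_le)
  ultimately show ?thesis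
    using \<open>k \<le> card S\<close> k by simp
qed

theorem theorem11:
  "\<exists>C :: nat wgraph set.
     (\<forall>G\<in>C. valid G \<and>
        (\<forall>S. optimal G S \<longrightarrow> card S = nat \<lceil>3 * ln (real (card (verts G)))\<rceil>)) \<and>
     (\<exists>c::real. c > 0 \<and> (\<exists>n0. \<forall>n\<ge>n0.
        (\<exists>G\<in>C. card (verts G) = n) \<and>
        (\<forall>G\<in>C. card (verts G) = n \<longrightarrow>
           expected_postponements G \<ge> ennreal (c * (real n * ln (ln (real n)))))))"
proof -
  define k where "k n = nat \<lceil>3 * ln (real n)\<rceil>" for n :: nat
  \<comment> \<open>Room for \<open>k n\<close> vertices is needed, and
    \<open>3 * ln n \<le> n\<close> fails for some small \<open>n\<close>.\<close>
  have "\<forall>\<^sub>F n :: nat in sequentially. 3 * ln (real n) \<le> real n"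
    by real_asymp
  then obtain m where m: "\<And>n. n \<ge> m \<Longrightarrow> 3 * ln (real n) \<le> real n"
    by (auto simp: eventually_sequentially)
  \<comment> \<open>\<open>n \<ge> 2\<close> makes \<open>ln n\<close> positive, which gives
    \<open>k n > 0\<close> and a meaningful iterated logarithm.\<close>
  define C where "C = {clique_instance n (k n) | n. n \<ge> max m 2}"
  have verts: "card (verts (clique_instance n j)) = n" for n j
    by (simp add: clique_instance_def)
  have "card S = k (card (verts G))" if GC: "G \<in> C" and S: "optimal G S" for G S
  proof -
    obtain n where n: "G = clique_instance n (k n)" "n \<ge> m" "n \<ge> 2"
      using GC by (auto simp: C_def)
    then have "0 < ln (real n)"
      by simp
    then have "0 < k n"
      by (simp add: k_def)
    moreover have "k n \<le> n"
      using m[OF n(2)] by (simp add: k_def nat_le_iff ceiling_le_iff)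
    ultimately show ?thesis
      using card_optimal_clique_instance[of "k n" n S] S n(1) by (simp add: verts)
  qed
  moreover have valid: "valid G" if "G \<in> C" for G
    using that by (auto simp: C_def valid_clique_instance)
  moreover have "\<exists>G\<in>C. card (verts G) = n" if "n \<ge> max m 2" for n
    using that verts by (auto simp: C_def)
  moreover have "ennreal (1 * (real n * ln (ln (real n)))) \<le> expected_postponements G"
    if G: "G \<in> C" "card (verts G) = n" and n: "n \<ge> max m 2" for G n
  proof -
    \<comment> \<open>The -1 in \<open>ln x \<le> x - 1\<close> at \<open>x = ln n\<close> absorbs
      the subtracted \<open>n\<close> of the bound.\<close>
    have "ln (ln (real n)) \<le> ln (real n) - 1"
      using n by (intro ln_le_minus_one) auto
    also have "\<dots> \<le> harm n - 1"
      using ln_le_harm[of n] n ln_mono[of "real n" "real n + 1"] by linarith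
    finally have "real n * ln (ln (real n)) \<le> real n * (harm n - 1)"
      by (intro mult_left_mono) auto
    then have "1 * (real n * ln (ln (real n))) \<le> real n * harm n - real n"
      by (simp add: algebra_simps)
    then show ?thesis
      using expected_postponements_ge[OF valid[OF G(1)]] G(2)
      by (auto intro: ennreal_leI order_trans)
  qed
  ultimately show ?thesis
    unfolding k_def by (intro exI[of _ C] conjI exI[of _ "1::real"] exI[of _ "max m 2"]) auto
qed

end
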